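(* Let $\gamma,\alpha,\lambda$ be umbrae, let $m$ be an integer, and let $n,k$ be integers with $n-k\ge 0$. Then \[ (\gamma+k.\alpha)^{n-k}\simeq\sum_{i=0}^{n-k}\binom{n-k}{i}\big(\gamma+(k-m).\alpha+i.\lambda\big)^{n-k-i}\; m.\alpha\big(m.\alpha+(-i).\lambda\big)^{i-1}, \] equivalently \[ (\gamma+k.\alpha)^{n-k}\simeq(n-k)!\sum_{i=0}^{n-k}\frac{\big(\gamma+(k-m).\alpha+i.\lambda\big)^{n-k-i}}{(n-k-i)!}\;\frac{m.\alpha\big(m.\alpha+(-i).\lambda\big)^{i-1}}{i!}. \]
   Context: Classical umbral calculus (Rota–Taylor). Let $R=\mathbb{C}[x]$ and let $A$ be a saturated alphabet of commuting indeterminates called umbrae; $E:R[A]\to R$ is the $R$-linear "evaluation" with $E[1]=1$ and $E[\alpha^i\beta^j\cdots\gamma^k]=E[\alpha^i]E[\beta^j]\cdots E[\gamma^k]$ for pairwise distinct umbrae (uncorrelation). For umbral polynomials, $p\simeq q$ means $E[p]=E[q]$; $p\equiv q$ means $p^n\simeq q^n$ for all $n\ge0$. The generating function of an umbra $\alpha$ is $f_\alpha(t)=\sum_{n\ge0}E[\alpha^n]t^n/n!$ (with $E[\alpha^0]=1$); saturation means every sequence with first term $1$ is represented by infinitely many distinct umbrae. For $x\in R\cup A$ (in particular any integer, possibly negative) the auxiliary umbra $x.\alpha$ is defined up to similarity by $(x.\alpha)^n\simeq n![t^n](f_\alpha(t))^x$. Convention: distinct auxiliary umbrae written in a formula (e.g.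 $\gamma$, $(k-m).\alpha$, $i.\lambda$, $m.\alpha$, $(-i).\lambda$) are represented by mutually uncorrelated umbrae, while repeated occurrences of the same expression within one factor of the form $\sigma(\sigma+\cdots)^{i-1}$ denote the same umbra; for $i=0$ the factor $\sigma(\sigma+(-0).\lambda)^{-1}$ is interpreted as $1$. *)

theory Defs
  imports
    "HOL-Library.Poly_Mapping"
    "HOL-Computational_Algebra.Polynomial"
    "HOL-Computational_Algebra.Formal_Power_Series"
begin

text \<open>
  The ring \<open>R[A]\<close> with \<open>R = \<complex>[x]\<close>: the type variable \<open>'a\<close> is the alphabet \<open>A\<close>, a monomial is a
  finitely supported exponent function, and the product is the convolution product.
\<close>

type_synonym 'a umbral_poly = "('a \<Rightarrow>\<^sub>0 nat) \<Rightarrow>\<^sub>0 complex poly"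

definition umb_const :: "complex poly \<Rightarrow> 'a umbral_poly" where
  "umb_const r = Poly_Mapping.single 0 r"

definition umb :: "'a \<Rightarrow> 'a umbral_poly" where
  "umb a = Poly_Mapping.single (Poly_Mapping.single a 1) 1"

text \<open>
  In \<open>uncorrelation\<close>, the finite set \<open>S\<close> enforces that the umbrae are pairwise distinct.
\<close>

locale saturated_umbral_calculus =
  fixes E :: "'a umbral_poly \<Rightarrow> complex poly"
  assumes eval_add: "E (p + q) = E p + E q"
    and eval_scale: "E (umb_const r * p) = r * E p"
    and eval_one: "E 1 = 1"
    and uncorrelation: "finite S \<Longrightarrow> E (\<Prod>a\<in>S. umb a ^ e a) = (\<Prod>a\<in>S. E (umb a ^ e a))"
    and saturation: "s 0 = 1 \<Longrightarrow> infinite {a. \<forall>n. E (umb a ^ n) = s n}"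

definition umb_equiv :: "'a umbral_poly \<Rightarrow> ('a umbral_poly \<Rightarrow> complex poly) \<Rightarrow> 'a umbral_poly \<Rightarrow> bool"
    (\<open>(_ \<simeq>\<^bsub>_\<^esub> _)\<close> [51, 0, 51] 50) where
  "p \<simeq>\<^bsub>E\<^esub> q \<longleftrightarrow> E p = E q"

definition umb_gf :: "('a umbral_poly \<Rightarrow> complex poly) \<Rightarrow> 'a \<Rightarrow> complex poly fps" where
  "umb_gf E a = Abs_fps (\<lambda>n. smult (1 / fact n) (E (umb a ^ n)))"

text \<open>
  Integer powers of a power series with constant term 1. The coefficients lie in the ring
  \<open>\<complex>[x]\<close>, which is not a field, so \<open>inverse\<close> and \<open>powi\<close> are unavailable; see
  \<open>fps_int_power_inverse\<close> below for the negative exponents.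
\<close>

definition fps_int_power :: "complex poly fps \<Rightarrow> int \<Rightarrow> complex poly fps" where
  "fps_int_power f x =
     (if x \<ge> 0 then f ^ nat x else (fps_right_inverse f 1) ^ nat (- x))"

text \<open>
  The auxiliary umbra \<open>x.a\<close> is only defined up to similarity: \<open>represents_dot E d x a\<close> says that
  the umbra \<open>d\<close> of the alphabet represents it.
\<close>

definition represents_dot :: "('a umbral_poly \<Rightarrow> complex poly) \<Rightarrow> 'a \<Rightarrow> int \<Rightarrow> 'a \<Rightarrow> bool" where
  "represents_dot E d x a \<longleftrightarrow>
     (\<forall>n. umb d ^ n \<simeq>\<^bsub>E\<^esub> umb_const (fact n * fps_nth (fps_int_power (umb_gf E a) x) n))"

text \<open>
  The factor \<open>\<sigma>(\<sigma> + \<tau>)\<^bsup>i-1\<^esup>\<close>, which is read as 1 for \<open>i = 0\<close>.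
\<close>

definition abel_factor :: "'a \<Rightarrow> 'a \<Rightarrow> nat \<Rightarrow> 'a umbral_poly" where
  "abel_factor \<sigma> \<tau> i = (if i = 0 then 1 else umb \<sigma> * (umb \<sigma> + umb \<tau>) ^ (i - 1))"


lemma fps_int_power_inverse:
  assumes "fps_nth f 0 = 1"
  shows "fps_int_power f x * fps_int_power f (- x) = 1"
proof -
  have inv: "f * fps_right_inverse f 1 = 1"
    by (rule fps_right_inverse) (simp add: assms)
  have "f ^ n * fps_right_inverse f 1 ^ n = 1" for n
    by (metis inv power_mult_distrib power_one)
  then show ?thesis
    by (cases "x = 0") (auto simp: fps_int_power_def mult.commute)
qed

lemma fps_int_power_nth_0:
  assumes "fps_nth f 0 = 1"
  shows "fps_nth (fps_int_power f x) 0 = 1"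
  by (simp add: fps_int_power_def assms fps_power_zeroth)

text \<open>
  Saturation supplies, outside any finite set of umbrae, a representative of \<open>x.a\<close>.
\<close>

lemma (in saturated_umbral_calculus) ex_represents_dot:
  assumes "finite B"
  shows "\<exists>d. d \<notin> B \<and> represents_dot E d x a"
proof -
  define s where "s = (\<lambda>n. fact n * fps_nth (fps_int_power (umb_gf E a) x) n)"
  have "s 0 = 1"
    unfolding s_def
    by (subst fps_int_power_nth_0) (simp_all add: umb_gf_def eval_one)
  then have "infinite {d. \<forall>n. E (umb d ^ n) = s n}"
    by (rule saturation)
  with assms have "infinite ({d. \<forall>n. E (umb d ^ n) = s n} - B)"
    by (simp add: Diff_infinite_finite)
  then have "{d. \<forall>n. E (umb d ^ n) = s n} - B \<noteq> {}"
    by (metis finite.emptyI)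
  then obtain d where d: "d \<notin> B" "\<forall>n. E (umb d ^ n) = s n"
    by auto
  have "E (umb_const r) = r" for r
    using eval_scale[of r 1] by (simp add: eval_one)
  with d show ?thesis
    by (auto simp: represents_dot_def umb_equiv_def s_def)
qed

text \<open>
  A saturated alphabet exists: infinitely many copies of each sequence.
\<close>

lemma ex_saturated_umbral_calculus:
  "\<exists>E :: (nat \<times> (nat \<Rightarrow> complex poly)) umbral_poly \<Rightarrow> complex poly. saturated_umbral_calculus E"
proof -
  define M :: "nat \<times> (nat \<Rightarrow> complex poly) \<Rightarrow> nat \<Rightarrow> complex poly"
    where "M a i = (if i = 0 then 1 else snd a i)" for a i
  define W :: "((nat \<times> (nat \<Rightarrow> complex poly)) \<Rightarrow>\<^sub>0 nat) \<Rightarrow> complex poly"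
    where "W u = (\<Prod>a\<in>Poly_Mapping.keys u. M a (Poly_Mapping.lookup u a))" for u
  define E where "E p = (\<Sum>u\<in>Poly_Mapping.keys p. Poly_Mapping.lookup p u * W u)" for p
  have E_superset: "E p = (\<Sum>u\<in>K. Poly_Mapping.lookup p u * W u)"
    if "finite K" "Poly_Mapping.keys p \<subseteq> K" for p K
    unfolding E_def using that
    by (intro sum.mono_neutral_left) (auto simp: in_keys_iff)
  have W_superset: "W u = (\<Prod>a\<in>K. M a (Poly_Mapping.lookup u a))"
    if "finite K" "Poly_Mapping.keys u \<subseteq> K" for u K
    unfolding W_def using that
    by (intro prod.mono_neutral_left) (auto simp: in_keys_iff M_def)
  have add: "E (p + q) = E p + E q" for p q
  proof -
    let ?K = "Poly_Mapping.keys p \<union> Poly_Mapping.keys q"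
    have "E (p + q) = (\<Sum>u\<in>?K. Poly_Mapping.lookup (p + q) u * W u)"
      by (rule E_superset) (auto simp: keys_add)
    also have "\<dots> = (\<Sum>u\<in>?K. Poly_Mapping.lookup p u * W u) + (\<Sum>u\<in>?K. Poly_Mapping.lookup q u * W u)"
      by (simp add: lookup_add distrib_right sum.distrib)
    also have "\<dots> = E p + E q"
      by (subst (1 2) E_superset[of ?K]) auto
    finally show ?thesis .
  qed
  have scale: "E (umb_const r * p) = r * E p" for r p
  proof -
    have eq: "umb_const r * p = Poly_Mapping.map ((*) r) p"
      by (simp add: umb_const_def mult_map_scale_conv_mult)
    have lk: "Poly_Mapping.lookup (Poly_Mapping.map ((*) r) p) u = r * Poly_Mapping.lookup p u" for u
      by (simp add: Poly_Mapping.map.rep_eq when_def)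
    have "Poly_Mapping.keys (Poly_Mapping.map ((*) r) p) \<subseteq> Poly_Mapping.keys p"
      by (auto simp: in_keys_iff lk)
    then have "E (umb_const r * p) = (\<Sum>u\<in>Poly_Mapping.keys p. r * Poly_Mapping.lookup p u * W u)"
      unfolding eq by (subst E_superset[of "Poly_Mapping.keys p"]) (auto simp: lk)
    then show ?thesis
      by (simp add: E_def sum_distrib_left mult.assoc)
  qed
  have E_single: "E (Poly_Mapping.single u 1) = W u" for u
    by (simp add: E_def)
  have umb_power: "umb a ^ n = Poly_Mapping.single (Poly_Mapping.single a n) 1"
    for a :: "nat \<times> (nat \<Rightarrow> complex poly)" and n
    by (induction n) (simp_all add: umb_def mult_single flip: single_add)
  have E_one: "E 1 = 1"
    using E_single[of 0] by (simp add: W_def)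
  have E_power: "E (umb a ^ n) = M a n" for a n
    by (cases "n = 0") (simp_all add: umb_power E_single E_one W_def M_def)
  have mono: "(\<Prod>a\<in>S. umb a ^ e a) = Poly_Mapping.single (\<Sum>a\<in>S. Poly_Mapping.single a (e a)) 1"
    if "finite S" for S :: "(nat \<times> (nat \<Rightarrow> complex poly)) set" and e
    using that by (induction S rule: finite_induct) (simp_all add: umb_power mult_single)
  have uncorr: "E (\<Prod>a\<in>S. umb a ^ e a) = (\<Prod>a\<in>S. E (umb a ^ e a))" if "finite S" for S e
  proof -
    let ?u = "\<Sum>a\<in>S. Poly_Mapping.single a (e a)"
    have lk: "Poly_Mapping.lookup ?u b = (if b \<in> S then e b else 0)" for b
      using that by (simp add: lookup_sum lookup_single when_def)
    have "W ?u = (\<Prod>a\<in>S. M a (Poly_Mapping.lookup ?u a))"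
      by (rule W_superset) (use that in \<open>auto simp: in_keys_iff lk split: if_splits\<close>)
    also have "\<dots> = (\<Prod>a\<in>S. M a (e a))"
      by (intro prod.cong) (auto simp: lk)
    finally show ?thesis
      using that by (simp add: mono E_single E_power)
  qed
  have sat: "infinite {a. \<forall>n. E (umb a ^ n) = s n}" if "s 0 = 1" for s
  proof -
    have "range (\<lambda>j. (j, s)) \<subseteq> {a. \<forall>n. E (umb a ^ n) = s n}"
      using that by (auto simp: E_power M_def)
    moreover have "infinite (range (\<lambda>j::nat. (j, s)))"
      by (rule range_inj_infinite) (auto simp: inj_on_def)
    ultimately show ?thesis
      by (rule infinite_super)
  qed
  have "saturated_umbral_calculus E"
    by unfold_locales (simp_all add: add scale E_one uncorr sat)
  then show ?thesis by blast
qed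

end

theory Submission
  imports Defs
begin

text \<open>
  Write \<open>f\<close>, \<open>g\<close>, \<open>h\<close> for the generating functions of \<open>\<alpha>\<close>, \<open>\<lambda>\<close>, \<open>\<gamma>\<close> and \<open>F = f\<^sup>m\<close>. Multiplication by an
  umbra \<open>\<sigma>\<close> differentiates the generating function of \<open>\<sigma>\<close>, so the value of
  \<open>\<sigma> (\<sigma> + (-i).\<lambda>)\<^bsup>i-1\<^esup> / i!\<close> for \<open>\<sigma> = m.\<alpha>\<close> is \<open>c\<^sub>i = [t\<^bsup>i-1\<^esup>] F' g\<^bsup>-i\<^esup> / i\<close>. By Lagrange inversion
  these are the coefficients of the expansion \<open>F = \<Sum>i. c\<^sub>i (t g)\<^sup>i\<close>. Multiplying it by \<open>h f\<^bsup>k-m\<^esup>\<close> and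
  comparing coefficients of \<open>t\<^bsup>n-k\<^esup>\<close> gives the theorem.
\<close>

subsection \<open>Lagrange inversion over an integral domain\<close>

text \<open>As \<open>g\<close> has constant term 1, \<open>(fps_X * g) ^ j\<close> starts with
  exactly \<open>fps_X ^ j\<close>, so the coefficients can be peeled off one at a time without
  division. The remainder term keeps the expansion finite.\<close>

lemma fps_expansion_in_powers:
  fixes F g :: "'r::comm_ring_1 fps"
  assumes "fps_nth g 0 = 1"
  shows "\<exists>c G. F = (\<Sum>j\<le>N. fps_const (c j) * (fps_X * g) ^ j) + fps_X ^ Suc N * G"
proof (induction N)
  case 0
  have "F = fps_const (fps_nth F 0) + fps_X * fps_shift 1 F"
    by (rule fps_ext) (simp add: fps_X_mult_nth)
  then show ?case
    by (intro exI[of _ "\<lambda>_. fps_nth F 0"] exI[of _ "fps_shift 1 F"]) simp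
next
  case (Suc N)
  then obtain c G where F: "F = (\<Sum>j\<le>N. fps_const (c j) * (fps_X * g) ^ j) + fps_X ^ Suc N * G"
    by blast
  \<comment> \<open>Subtracting \<open>a * g ^ Suc N\<close> cancels the constant term of
    \<open>G\<close>, which makes the remainder divisible by one more \<open>fps_X\<close>.\<close>
  define a where "a = fps_nth G 0"
  define H where "H = G - fps_const a * g ^ Suc N"
  have "fps_nth H 0 = 0"
    by (simp add: H_def a_def fps_power_zeroth assms)
  then have "H = fps_X * fps_shift 1 H"
    by (intro fps_ext) (simp add: fps_X_mult_nth)
  then have G: "G = fps_const a * g ^ Suc N + fps_X * fps_shift 1 H"
    by (simp add: H_def algebra_simps)
  have sum: "(\<Sum>j\<le>N. fps_const ((c(Suc N := a)) j) * (fps_X * g) ^ j)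
      = (\<Sum>j\<le>N. fps_const (c j) * (fps_X * g) ^ j)"
    by (intro sum.cong) auto
  have "F = (\<Sum>j\<le>Suc N. fps_const ((c(Suc N := a)) j) * (fps_X * g) ^ j)
          + fps_X ^ Suc (Suc N) * fps_shift 1 H"
    unfolding sum.atMost_Suc sum
    by (subst F, subst G) (simp add: power_mult_distrib algebra_simps)
  then show ?case
    by blast
qed

text \<open>
  This is the vanishing of the residue of \<open>(y\<^bsup>-d\<^esup>)'\<close> for \<open>y = t g\<close>, without Laurent series.
\<close>

lemma fps_residue_deriv_power:
  fixes g u :: "'r::{idom,ring_char_0} fps"
  assumes gu: "g * u = 1" and d: "d > 0"
  shows "fps_nth (u ^ d + fps_X * (fps_deriv g * u ^ Suc d)) d = 0"
proof -
  obtain e where e: "d = Suc e"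
    using d by (cases d) auto
  have "fps_deriv g * u + g * fps_deriv u = 0"
    using arg_cong[OF gu, of fps_deriv] by (simp add: algebra_simps)
  \<comment> \<open>Multiplying by \<open>u\<close> turns the factor \<open>g\<close> of
    \<open>fps_deriv u\<close> into 1, which solves for the derivative.\<close>
  then have "u * (fps_deriv g * u + g * fps_deriv u) = 0"
    by simp
  then have "fps_deriv g * u * u + (g * u) * fps_deriv u = 0"
    by (simp add: algebra_simps)
  then have u': "fps_deriv u = - (fps_deriv g * u * u)"
    by (simp add: gu add_eq_0_iff)
  have "fps_deriv (u ^ d) = - (of_nat d * (fps_deriv g * u ^ Suc d))"
    by (subst fps_deriv_power') (simp add: u' e algebra_simps del: of_nat_Suc)
  then have "fps_nth (fps_deriv (u ^ d)) e = - (of_nat d * fps_nth (fps_deriv g * u ^ Suc d) e)"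
    by (simp flip: fps_of_nat)
  moreover have "fps_nth (fps_deriv (u ^ d)) e = of_nat d * fps_nth (u ^ d) d"
    by (simp only: fps_deriv_nth e Suc_eq_plus1)
  ultimately have "of_nat d * fps_nth (u ^ d) d = - (of_nat d * fps_nth (fps_deriv g * u ^ Suc d) e)"
    by simp
  then have "of_nat d * fps_nth (u ^ d + fps_X * (fps_deriv g * u ^ Suc d)) d = 0"
    by (simp add: e fps_X_mult_nth distrib_left del: of_nat_Suc power_Suc)
  \<comment> \<open>Cancelling \<open>d\<close> uses characteristic 0 and the absence of zero
    divisors.\<close>
  then show ?thesis
    using d by (simp del: of_nat_Suc)
qed

text \<open>With \<open>y = fps_X * g\<close> and \<open>u = 1 / g\<close>, the left side is the
  residue of \<open>(y ^ j)' / y ^ Suc r\<close>. For \<open>j\<close> different from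
  \<open>Suc r\<close> this is a multiple of the derivative of a power of \<open>y\<close> and has
  no residue; for \<open>j = Suc r\<close> it is \<open>j\<close> times the logarithmic derivative
  of \<open>y\<close>.\<close>

lemma fps_nth_deriv_power_orthogonal:
  fixes g u :: "'r::{idom,ring_char_0} fps"
  assumes gu: "g * u = 1" and g0: "fps_nth g 0 = 1"
  shows "fps_nth (fps_deriv ((fps_X * g) ^ j) * u ^ Suc r) r = (if j = Suc r then of_nat j else 0)"
proof (cases j)
  case 0
  then show ?thesis by simp
next
  case (Suc s)
  have gu_power: "g ^ n * u ^ n = 1" for n
    by (metis gu power_mult_distrib power_one)
  have eq: "fps_deriv ((fps_X * g) ^ j) * u ^ Suc r
      = fps_const (of_nat j) * (fps_X ^ s * (g ^ s * (g + fps_X * fps_deriv g) * u ^ Suc r))"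
    by (subst fps_deriv_power) (simp add: Suc power_mult_distrib algebra_simps del: of_nat_Suc)
  have lhs: "fps_nth (fps_deriv ((fps_X * g) ^ j) * u ^ Suc r) r
      = (if r < s then 0 else
         of_nat j * fps_nth (g ^ s * (g + fps_X * fps_deriv g) * u ^ Suc r) (r - s))"
    by (simp only: eq fps_mult_left_const_nth fps_X_power_mult_nth) simp
  show ?thesis
  proof (cases "r \<le> s")
    case True
    have "fps_nth u 0 = 1"
      using arg_cong[OF gu, of "\<lambda>w. fps_nth w 0"] by (simp add: g0)
    then show ?thesis
      unfolding lhs using True by (auto simp: Suc g0 fps_power_zeroth)
  next
    case False
    define d where "d = r - s"
    have r: "r = s + d" and d: "d > 0"
      using False by (auto simp: d_def)
    \<comment> \<open>Cancelling \<open>g ^ s\<close> against \<open>u ^ s\<close> leaves the series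
      of the residue lemma, with \<open>d = r - s\<close>.\<close>
    have "g ^ s * (g + fps_X * fps_deriv g) * u ^ Suc r
        = (g ^ s * u ^ s) * ((g * u) * u ^ d + fps_X * (fps_deriv g * u ^ Suc d))"
      by (simp add: r power_add algebra_simps)
    also have "\<dots> = u ^ d + fps_X * (fps_deriv g * u ^ Suc d)"
      by (simp add: gu_power gu)
    finally show ?thesis
      unfolding lhs using False fps_residue_deriv_power[OF gu d] by (simp only: Suc d_def) simp
  qed
qed

text \<open>Orthogonality identifies the coefficients of the truncated expansion of \<open>F\<close>
  with the \<open>c i\<close>; multiplying by \<open>H\<close> then gives the claim, as the
  remainder starts beyond \<open>fps_X ^ N\<close>. The assumption on \<open>c i\<close> carries the
  factor \<open>of_nat i\<close> because the coefficient ring may not allow division.\<close>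

theorem fps_Lagrange_expansion:
  fixes F g u H :: "'r::{idom,ring_char_0} fps"
  assumes gu: "g * u = 1" and g0: "fps_nth g 0 = 1"
    and c0: "c 0 = fps_nth F 0"
    and c: "\<And>i. 0 < i \<Longrightarrow> i \<le> N \<Longrightarrow> of_nat i * c i = fps_nth (fps_deriv F * u ^ i) (i - 1)"
  shows "fps_nth (H * F) N = (\<Sum>i\<le>N. c i * fps_nth (H * g ^ i) (N - i))"
proof -
  obtain b G where F: "F = (\<Sum>j\<le>N. fps_const (b j) * (fps_X * g) ^ j) + fps_X ^ Suc N * G"
    using fps_expansion_in_powers[OF g0] by blast
  have "b i = c i" if i: "i \<le> N" for i
  proof (cases i)
    case 0
    \<comment> \<open>The derivative forgets the constant term, so index 0 is compared
      directly.\<close>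
    have "fps_nth F 0 = (\<Sum>j\<le>N. b j * 0 ^ j)"
      by (subst F) (simp add: fps_sum_nth fps_power_zeroth)
    also have "\<dots> = (\<Sum>j\<le>N. if j = 0 then b j else 0)"
      by (intro sum.cong) (auto simp: power_0_left)
    finally show ?thesis
      using 0 c0 by simp
  next
    case (Suc r)
    \<comment> \<open>Differentiation lowers the order of the remainder to \<open>N\<close>, still
      above the index \<open>r = i - 1\<close>.\<close>
    have G': "fps_deriv (fps_X ^ Suc N * G) = fps_X ^ N * (of_nat (Suc N) * G + fps_X * fps_deriv G)"
      unfolding fps_deriv_mult fps_deriv_power' by (simp add: algebra_simps del: of_nat_Suc)
    have F': "fps_deriv F * u ^ Suc r = (\<Sum>j\<le>N. fps_const (b j) * (fps_deriv ((fps_X * g) ^ j) * u ^ Suc r))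
          + fps_X ^ N * ((of_nat (Suc N) * G + fps_X * fps_deriv G) * u ^ Suc r)"
      by (subst F) (simp only: fps_deriv_add fps_deriv_sum G' fps_deriv_mult_const_left
          distrib_right sum_distrib_right mult.assoc)
    have "of_nat i * c i = fps_nth (fps_deriv F * u ^ Suc r) r"
      using c[of i] i Suc by simp
    also have "\<dots> = (\<Sum>j\<le>N. b j * (if j = Suc r then of_nat j else 0))"
      using i Suc unfolding F'
      by (simp add: fps_sum_nth fps_X_power_mult_nth fps_nth_deriv_power_orthogonal[OF gu g0]
          del: power_Suc of_nat_Suc)
    also have "\<dots> = (\<Sum>j\<le>N. if j = i then b j * of_nat j else 0)"
      by (intro sum.cong) (auto simp: Suc)
    also have "\<dots> = of_nat i * b i"
      using i by simp
    finally show ?thesis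
      using Suc by (simp del: of_nat_Suc)
  qed
  moreover have "H * F = (\<Sum>j\<le>N. fps_const (b j) * (fps_X ^ j * (H * g ^ j))) + fps_X ^ Suc N * (H * G)"
    by (subst F) (simp add: sum_distrib_left power_mult_distrib algebra_simps)
  ultimately show ?thesis
    by (simp add: fps_sum_nth fps_X_power_mult_nth del: power_Suc)
qed

subsection \<open>Integer powers\<close>

text \<open>Writing an exponent as any difference of naturals confines the case split on its sign to
  this proof; the exponent laws below follow from it.\<close>

lemma fps_int_power_diff:
  assumes f0: "fps_nth f 0 = 1"
  shows "fps_int_power f (int a - int b) = f ^ a * fps_right_inverse f 1 ^ b"
proof -
  let ?u = "fps_right_inverse f 1"
  have "f * ?u = 1"
    by (rule fps_right_inverse) (simp add: f0)
  then have fu: "f ^ n * ?u ^ n = 1" for n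
    by (metis power_mult_distrib power_one)
  show ?thesis
  proof (cases "b \<le> a")
    case True
    then obtain d where d: "a = b + d"
      using le_Suc_ex by blast
    have "f ^ a * ?u ^ b = (f ^ b * ?u ^ b) * f ^ d"
      by (simp add: d power_add mult_ac)
    then show ?thesis
      by (simp add: fps_int_power_def d fu)
  next
    case False
    then obtain d where d: "b = a + d" "d > 0"
      by (metis less_imp_add_positive not_le)
    have "f ^ a * ?u ^ b = (f ^ a * ?u ^ a) * ?u ^ d"
      by (simp add: d power_add mult_ac)
    then show ?thesis
      using d by (simp add: fps_int_power_def fu)
  qed
qed

lemma fps_int_power_add:
  assumes "fps_nth f 0 = 1"
  shows "fps_int_power f (x + y) = fps_int_power f x * fps_int_power f y"
proof -
  obtain a b c d where "x = int a - int b" "y = int c - int d"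
    by (meson int_diff_cases)
  moreover from this have "x + y = int (a + c) - int (b + d)"
    by simp
  ultimately show ?thesis
    by (simp only: fps_int_power_diff[OF assms]) (simp add: power_add mult_ac)
qed

lemma fps_int_power_of_nat:
  assumes "fps_nth f 0 = 1"
  shows "fps_int_power f (int n) = f ^ n" and "fps_int_power f (- int n) = fps_int_power f (- 1) ^ n"
  using fps_int_power_diff[OF assms, of n 0] fps_int_power_diff[OF assms, of 0 n]
    fps_int_power_diff[OF assms, of 0 1] by simp_all

subsection \<open>Evaluation of uncorrelated polynomials\<close>

definition umb_vars :: "'a umbral_poly \<Rightarrow> 'a set" where
  "umb_vars p = (\<Union>u\<in>Poly_Mapping.keys p. Poly_Mapping.keys u)"

lemma umb_vars_umb [simp]: "umb_vars (umb a) = {a}"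
  by (simp add: umb_vars_def umb_def)

lemma umb_vars_one [simp]: "umb_vars 1 = {}"
  by (simp add: umb_vars_def)

lemma umb_vars_add: "umb_vars (p + q) \<subseteq> umb_vars p \<union> umb_vars q"
  using keys_add[of p q] by (auto simp: umb_vars_def)

lemma umb_vars_mult: "umb_vars (p * q) \<subseteq> umb_vars p \<union> umb_vars q"
proof
  fix a assume "a \<in> umb_vars (p * q)"
  then obtain w where w: "w \<in> Poly_Mapping.keys (p * q)" "a \<in> Poly_Mapping.keys w"
    by (auto simp: umb_vars_def)
  from w(1) obtain u v where "w = u + v" "u \<in> Poly_Mapping.keys p" "v \<in> Poly_Mapping.keys q"
    using keys_mult[of p q] by blast
  with w(2) keys_add[of u v] show "a \<in> umb_vars p \<union> umb_vars q"
    by (auto simp: umb_vars_def)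
qed

lemma umb_vars_power: "umb_vars (p ^ n) \<subseteq> umb_vars p"
proof (induction n)
  case (Suc n)
  then show ?case
    using umb_vars_mult[of p "p ^ n"] by auto
qed simp

lemma umb_power: "umb a ^ n = Poly_Mapping.single (Poly_Mapping.single a n) 1"
  by (induction n) (simp_all add: umb_def mult_single flip: single_add)

lemma poly_mapping_sum_monomials:
  "(\<Sum>u\<in>Poly_Mapping.keys p. Poly_Mapping.single u (Poly_Mapping.lookup p u)) = p"
  by (rule poly_mapping_eqI)
    (auto simp: lookup_sum lookup_single when_def in_keys_iff sum.delta)

text \<open>Reduces statements about the linear \<open>E\<close> to products of powers of distinct
  umbrae, the form to which \<open>uncorrelation\<close> applies.\<close>

lemma umbral_poly_eq_sum:
  "p = (\<Sum>u\<in>Poly_Mapping.keys p. umb_const (Poly_Mapping.lookup p u) *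
          (\<Prod>a\<in>Poly_Mapping.keys u. umb a ^ Poly_Mapping.lookup u a))"
proof -
  have mono: "(\<Prod>a\<in>S. umb a ^ e a) = Poly_Mapping.single (\<Sum>a\<in>S. Poly_Mapping.single a (e a)) 1"
    if "finite S" for S :: "'a set" and e
    using that by (induction S rule: finite_induct) (simp_all add: umb_power mult_single)
  show ?thesis
    by (simp add: mono umb_const_def mult_single poly_mapping_sum_monomials)
qed

lemma umb_const_mult: "umb_const (r * s) = umb_const r * umb_const s"
  by (simp add: umb_const_def mult_single)

lemma umb_const_of_nat: "umb_const (of_nat n) = of_nat n"
  by (induction n) (simp_all add: umb_const_def single_add)

lemma smult_sum_right: "smult c (\<Sum>i\<in>I. p i) = (\<Sum>i\<in>I. smult c (p i))"
  by (induction I rule: infinite_finite_induct) (simp_all add: smult_add_right)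

context saturated_umbral_calculus
begin

lemma eval_const: "E (umb_const r) = r"
  using eval_scale[of r 1] by (simp add: eval_one)

lemma eval_of_nat_mult: "E (of_nat n * p) = of_nat n * E p"
  using eval_scale[of "of_nat n" p] by (simp add: umb_const_of_nat)

lemma eval_sum: "E (\<Sum>i\<in>I. p i) = (\<Sum>i\<in>I. E (p i))"
\<comment> \<open>The instance \<open>eval_of_nat_mult[of 0 0]\<close> supplies
  \<open>E 0 = 0\<close>.\<close>
proof (cases "finite I")
  case True
  then show ?thesis
    by (induction I rule: finite_induct)
      (use eval_add eval_of_nat_mult[of 0 0] in auto)
qed (use eval_of_nat_mult[of 0 0] in simp)

text \<open>By linearity it suffices to treat monomials, and monomials with disjoint supports
  multiply to a single product over the union of the supports.\<close>

lemma eval_mult_uncorrelated: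
  assumes "umb_vars p \<inter> umb_vars q = {}"
  shows "E (p * q) = E p * E q"
proof -
  let ?P = "Poly_Mapping.keys p" and ?Q = "Poly_Mapping.keys q"
  define W :: "('a \<Rightarrow>\<^sub>0 nat) \<Rightarrow> 'a umbral_poly"
    where "W u = (\<Prod>a\<in>Poly_Mapping.keys u. umb a ^ Poly_Mapping.lookup u a)" for u
  have p: "p = (\<Sum>u\<in>?P. umb_const (Poly_Mapping.lookup p u) * W u)"
    and q: "q = (\<Sum>u\<in>?Q. umb_const (Poly_Mapping.lookup q u) * W u)"
    unfolding W_def by (rule umbral_poly_eq_sum)+
  have W: "E (W u * W v) = E (W u) * E (W v)" if "u \<in> ?P" "v \<in> ?Q" for u v
  proof -
    let ?A = "Poly_Mapping.keys u" and ?B = "Poly_Mapping.keys v"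
    \<comment> \<open>One exponent function serves both monomials, since their supports are
      disjoint.\<close>
    define e where "e a = (if a \<in> ?A then Poly_Mapping.lookup u a else Poly_Mapping.lookup v a)" for a
    have dis: "?A \<inter> ?B = {}"
      using assms that by (auto simp: umb_vars_def)
    have Wu: "W u = (\<Prod>a\<in>?A. umb a ^ e a)"
      unfolding W_def by (intro prod.cong) (auto simp: e_def)
    have Wv: "W v = (\<Prod>a\<in>?B. umb a ^ e a)"
      unfolding W_def using dis by (intro prod.cong) (auto simp: e_def)
    have "W u * W v = (\<Prod>a\<in>?A \<union> ?B. umb a ^ e a)"
      using dis by (simp add: Wu Wv prod.union_disjoint)
    then have "E (W u * W v) = (\<Prod>a\<in>?A \<union> ?B. E (umb a ^ e a))"
      by (simp only: uncorrelation finite_Un finite_keys simp_thms)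
    then show ?thesis
      using dis by (simp add: Wu Wv uncorrelation prod.union_disjoint)
  qed
  have "p * q = (\<Sum>u\<in>?P. \<Sum>v\<in>?Q.
      umb_const (Poly_Mapping.lookup p u * Poly_Mapping.lookup q v) * (W u * W v))"
    by (subst p, subst q) (simp add: sum_product umb_const_mult mult_ac)
  then have "E (p * q) = (\<Sum>u\<in>?P. \<Sum>v\<in>?Q.
      Poly_Mapping.lookup p u * Poly_Mapping.lookup q v * (E (W u) * E (W v)))"
    by (simp add: eval_sum eval_scale W)
  also have "\<dots> = (\<Sum>u\<in>?P. \<Sum>v\<in>?Q.
      (Poly_Mapping.lookup p u * E (W u)) * (Poly_Mapping.lookup q v * E (W v)))"
    by (simp add: mult_ac)
  also have "\<dots> = (\<Sum>u\<in>?P. Poly_Mapping.lookup p u * E (W u)) * (\<Sum>v\<in>?Q. Poly_Mapping.lookup q v * E (W v))"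
    by (simp only: sum_product)
  also have "\<dots> = E p * E q"
    by (subst (3) p, subst (3) q) (simp add: eval_sum eval_scale)
  finally show ?thesis .
qed

section \<open>Exponential generating functions of umbral polynomials\<close>

text \<open>
  The formal value of \<open>w e\<^bsup>pt\<^esup>\<close>; the weight \<open>w\<close> accommodates the factor \<open>\<sigma>\<close> in \<open>\<sigma> (\<sigma> + \<tau>)\<^bsup>i-1\<^esup>\<close>.
\<close>

definition weighted_gf :: "'a umbral_poly \<Rightarrow> 'a umbral_poly \<Rightarrow> complex poly fps" where
  "weighted_gf w p = Abs_fps (\<lambda>n. smult (1 / fact n) (E (w * p ^ n)))"

lemma weighted_gf_nth: "fps_nth (weighted_gf w p) n = smult (1 / fact n) (E (w * p ^ n))"
  by (simp add: weighted_gf_def)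

lemma eval_weighted: "E (w * p ^ n) = smult (fact n) (fps_nth (weighted_gf w p) n)"
  by (simp add: weighted_gf_nth)

lemma weighted_gf_one_umb: "weighted_gf 1 (umb a) = umb_gf E a"
  by (simp add: weighted_gf_def umb_gf_def)

lemma umb_gf_nth_0: "fps_nth (umb_gf E a) 0 = 1"
  by (simp add: umb_gf_def eval_one)

text \<open>Once \<open>E\<close> factors, the binomial theorem divided by \<open>fact n\<close> is
  a Cauchy product. The weight stays with \<open>p\<close>, so \<open>w\<close> and \<open>p\<close>
  may share umbrae.\<close>

lemma weighted_gf_add:
  assumes "(umb_vars w \<union> umb_vars p) \<inter> umb_vars q = {}"
  shows "weighted_gf w (p + q) = weighted_gf w p * weighted_gf 1 q"
proof (rule fps_ext)
  fix n
  have E_term: "E (w * p ^ i * q ^ j) = E (w * p ^ i) * E (q ^ j)" for i j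
    by (rule eval_mult_uncorrelated)
      (use assms umb_vars_mult[of w "p ^ i"] umb_vars_power[of p i] umb_vars_power[of q j] in blast)
  have coeff: "1 / fact n * of_nat (n choose i) = (1 / fact i * (1 / fact (n - i)) :: complex)"
    if "i \<le> n" for i
    using that by (simp add: binomial_fact)
  have "w * (p + q) ^ n = (\<Sum>i\<le>n. of_nat (n choose i) * (w * p ^ i * q ^ (n - i)))"
    by (simp add: binomial_ring sum_distrib_left mult_ac)
  then have "E (w * (p + q) ^ n)
      = (\<Sum>i\<le>n. smult (of_nat (n choose i)) (E (w * p ^ i) * E (q ^ (n - i))))"
    by (simp add: eval_sum eval_of_nat_mult E_term of_nat_poly)
  then have "smult (1 / fact n) (E (w * (p + q) ^ n))
      = (\<Sum>i\<le>n. smult (1 / fact n * of_nat (n choose i)) (E (w * p ^ i) * E (q ^ (n - i))))"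
    by (simp add: smult_sum_right)
  also have "\<dots> = (\<Sum>i\<le>n. smult (1 / fact i) (E (w * p ^ i)) * smult (1 / fact (n - i)) (E (q ^ (n - i))))"
    by (intro sum.cong refl, subst coeff) (simp_all add: mult.commute)
  finally show "fps_nth (weighted_gf w (p + q)) n = fps_nth (weighted_gf w p * weighted_gf 1 q) n"
    by (simp add: weighted_gf_nth fps_mult_nth atLeast0AtMost)
qed

text \<open>The extra factor \<open>p\<close> shifts the moments by one, as differentiation does for
  exponential generating functions.\<close>

lemma weighted_gf_self: "weighted_gf p p = fps_deriv (weighted_gf 1 p)"
proof (rule fps_ext)
  fix n
  have "fps_nth (fps_deriv (weighted_gf 1 p)) n
      = smult (of_nat (Suc n)) (smult (1 / fact (Suc n)) (E (p ^ Suc n)))"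
    by (simp add: weighted_gf_nth of_nat_poly del: of_nat_Suc fact_Suc)
  also have "\<dots> = smult (1 / fact n) (E (p ^ Suc n))"
    by (simp del: of_nat_Suc)
  finally show "fps_nth (weighted_gf p p) n = fps_nth (fps_deriv (weighted_gf 1 p)) n"
    by (simp add: weighted_gf_nth)
qed

lemma represents_dot_umb_gf:
  assumes "represents_dot E d x a"
  shows "umb_gf E d = fps_int_power (umb_gf E a) x"
proof (rule fps_ext)
  fix n
  have "E (umb d ^ n) = smult (fact n) (fps_nth (fps_int_power (umb_gf E a) x) n)"
    using assms of_nat_poly[of "fact n", where ?'a = complex]
    by (simp add: represents_dot_def umb_equiv_def eval_const)
  then show "fps_nth (umb_gf E d) n = fps_nth (fps_int_power (umb_gf E a) x) n"
    by (simp add: umb_gf_def)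
qed

end

text \<open>Auxiliary umbrae are fixed only up to similarity, so their representatives are arbitrary
  and may vary with \<open>i\<close>. As \<open>E\<close> is linear, uncorrelation matters only
  inside each summand.\<close>

theorem theorem3p10:
  fixes E :: "'a umbral_poly \<Rightarrow> complex poly"
    and \<gamma> \<alpha> \<Lambda> :: 'a
    and n k m :: int
    and k\<alpha> :: 'a
    and km\<alpha> i\<Lambda> m\<alpha> ni\<Lambda> :: "nat \<Rightarrow> 'a"
  assumes "saturated_umbral_calculus E"
    and "n - k \<ge> 0"
    and "represents_dot E k\<alpha> k \<alpha>"
    and "\<gamma> \<noteq> k\<alpha>"
    and "\<And>i. i \<le> nat (n - k) \<Longrightarrow> represents_dot E (km\<alpha> i) (k - m) \<alpha>"
    and "\<And>i. i \<le> nat (n - k) \<Longrightarrow> represents_dot E (i\<Lambda> i) (int i) \<Lambda>"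
    and "\<And>i. i \<le> nat (n - k) \<Longrightarrow> represents_dot E (m\<alpha> i) m \<alpha>"
    and "\<And>i. i \<le> nat (n - k) \<Longrightarrow> represents_dot E (ni\<Lambda> i) (- int i) \<Lambda>"
    and "\<And>i. i \<le> nat (n - k) \<Longrightarrow> distinct [\<gamma>, km\<alpha> i, i\<Lambda> i, m\<alpha> i, ni\<Lambda> i]"
  shows "(umb \<gamma> + umb k\<alpha>) ^ nat (n - k) \<simeq>\<^bsub>E\<^esub>
           (\<Sum>i = 0..nat (n - k). of_nat (nat (n - k) choose i) *
              (umb \<gamma> + umb (km\<alpha> i) + umb (i\<Lambda> i)) ^ (nat (n - k) - i) *
              abel_factor (m\<alpha> i) (ni\<Lambda> i) i)
       \<and> (umb \<gamma> + umb k\<alpha>) ^ nat (n - k) \<simeq>\<^bsub>E\<^esub>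
           fact (nat (n - k)) *
           (\<Sum>i = 0..nat (n - k).
              (umb_const [:1 / fact (nat (n - k) - i):] *
                 (umb \<gamma> + umb (km\<alpha> i) + umb (i\<Lambda> i)) ^ (nat (n - k) - i)) *
              (umb_const [:1 / fact i:] * abel_factor (m\<alpha> i) (ni\<Lambda> i) i))"
proof -
  interpret saturated_umbral_calculus E
    by fact
  define N where "N = nat (n - k)"
  define f g h where "f = umb_gf E \<alpha>" and "g = umb_gf E \<Lambda>" and "h = umb_gf E \<gamma>"
  define u where "u = fps_int_power g (- 1)"
  \<comment> \<open>Splitting \<open>f^k\<close> as \<open>f^(k-m)\<close> times \<open>f^m\<close>
    makes \<open>H * F\<close> the generating function of the left side, and
    \<open>H * g ^ i\<close> that of \<open>P i\<close>.\<close>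
  define H where "H = h * fps_int_power f (k - m)"
  define F where "F = fps_int_power f m"
  define P where "P i = umb \<gamma> + umb (km\<alpha> i) + umb (i\<Lambda> i)" for i
  define Q where "Q i = abel_factor (m\<alpha> i) (ni\<Lambda> i) i" for i
  define c where "c i = smult (1 / fact i) (E (Q i))" for i
  have f0: "fps_nth f 0 = 1" and g0: "fps_nth g 0 = 1"
    by (simp_all add: f_def g_def umb_gf_nth_0)
  have gu: "g * u = 1"
    using fps_int_power_inverse[OF g0, of 1] by (simp add: u_def fps_int_power_def)
  have HF: "H * F = h * fps_int_power f k"
    using fps_int_power_add[OF f0, of "k - m" m] by (simp add: H_def F_def mult.assoc)

  have gf_lhs: "weighted_gf 1 (umb \<gamma> + umb k\<alpha>) = H * F"
    using assms(3,4) by (subst weighted_gf_add)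
      (simp_all add: weighted_gf_one_umb represents_dot_umb_gf HF f_def h_def)
  have gf_P: "weighted_gf 1 (P i) = H * g ^ i" if "i \<le> N" for i
  proof -
    have i: "i \<le> nat (n - k)"
      using that by (simp add: N_def)
    have dist: "\<gamma> \<noteq> km\<alpha> i" "\<gamma> \<noteq> i\<Lambda> i" "km\<alpha> i \<noteq> i\<Lambda> i"
      using assms(9)[OF i] by auto
    have "weighted_gf 1 (P i) = weighted_gf 1 (umb \<gamma> + umb (km\<alpha> i)) * weighted_gf 1 (umb (i\<Lambda> i))"
      unfolding P_def
      by (rule weighted_gf_add) (use dist umb_vars_add[of "umb \<gamma>" "umb (km\<alpha> i)"] in auto)
    also have "weighted_gf 1 (umb \<gamma> + umb (km\<alpha> i)) = weighted_gf 1 (umb \<gamma>) * weighted_gf 1 (umb (km\<alpha> i))"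
      by (rule weighted_gf_add) (use dist in auto)
    finally show ?thesis
      by (simp add: weighted_gf_one_umb represents_dot_umb_gf[OF assms(5)[OF i]]
          represents_dot_umb_gf[OF assms(6)[OF i]] H_def h_def fps_int_power_of_nat(1) g0
          flip: f_def g_def)
  qed
  have gf_Q: "of_nat i * c i = fps_nth (fps_deriv F * u ^ i) (i - 1)" if pos: "0 < i" and le: "i \<le> N" for i
  proof -
    have i: "i \<le> nat (n - k)"
      using le by (simp add: N_def)
    obtain r where r: "i = Suc r"
      using pos gr0_conv_Suc by blast
    have "weighted_gf (umb (m\<alpha> i)) (umb (m\<alpha> i) + umb (ni\<Lambda> i))
        = weighted_gf (umb (m\<alpha> i)) (umb (m\<alpha> i)) * weighted_gf 1 (umb (ni\<Lambda> i))"
      by (rule weighted_gf_add) (use assms(9)[OF i] in auto)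
    also have "\<dots> = fps_deriv F * u ^ i"
      by (simp add: weighted_gf_self weighted_gf_one_umb represents_dot_umb_gf[OF assms(7)[OF i]]
          represents_dot_umb_gf[OF assms(8)[OF i]] F_def u_def fps_int_power_of_nat(2)[OF g0]
          flip: f_def g_def)
    finally have "E (Q i) = smult (fact r) (fps_nth (fps_deriv F * u ^ i) r)"
      by (simp add: Q_def abel_factor_def r eval_weighted)
    \<comment> \<open>With \<open>r = i - 1\<close> the factorials collapse, which gives the
      coefficient condition of the Lagrange expansion.\<close>
    then have "of_nat i * c i = smult (of_nat i * (1 / fact i * fact r)) (fps_nth (fps_deriv F * u ^ i) r)"
      by (simp add: c_def of_nat_poly mult.commute)
    also have "of_nat i * (1 / fact i * fact r) = (1 :: complex)"
      by (simp add: r del: of_nat_Suc)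
    finally show ?thesis
      by (simp add: r)
  qed
  \<comment> \<open>The convention that the factor is 1 at \<open>i = 0\<close> matches the constant
    term 1 of \<open>F\<close>.\<close>
  have c0: "c 0 = fps_nth F 0"
    by (simp add: c_def Q_def abel_factor_def eval_one F_def fps_int_power_nth_0[OF f0])
  have eval_term: "E (of_nat (N choose i) * P i ^ (N - i) * Q i)
      = smult (fact N) (c i * fps_nth (H * g ^ i) (N - i))" if "i \<le> N" for i
  proof -
    have i: "i \<le> nat (n - k)"
      using that by (simp add: N_def)
    have vP: "umb_vars (P i ^ (N - i)) \<subseteq> {\<gamma>, km\<alpha> i, i\<Lambda> i}"
      using umb_vars_power[of "P i" "N - i"] umb_vars_add[of "umb \<gamma> + umb (km\<alpha> i)" "umb (i\<Lambda> i)"]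
        umb_vars_add[of "umb \<gamma>" "umb (km\<alpha> i)"] by (auto simp: P_def)
    have vQ: "umb_vars (Q i) \<subseteq> {m\<alpha> i, ni\<Lambda> i}"
      using umb_vars_mult[of "umb (m\<alpha> i)" "(umb (m\<alpha> i) + umb (ni\<Lambda> i)) ^ (i - 1)"]
        umb_vars_power[of "umb (m\<alpha> i) + umb (ni\<Lambda> i)" "i - 1"]
        umb_vars_add[of "umb (m\<alpha> i)" "umb (ni\<Lambda> i)"]
      by (auto simp: Q_def abel_factor_def)
    have "umb_vars (P i ^ (N - i)) \<inter> umb_vars (Q i) = {}"
      using vP vQ assms(9)[OF i] by auto
    then have "E (of_nat (N choose i) * P i ^ (N - i) * Q i)
        = of_nat (N choose i) * (E (P i ^ (N - i)) * E (Q i))"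
      by (simp add: mult.assoc eval_of_nat_mult eval_mult_uncorrelated)
    also have "E (P i ^ (N - i)) = smult (fact (N - i)) (fps_nth (H * g ^ i) (N - i))"
      using eval_weighted[of 1 "P i" "N - i"] that by (simp add: gf_P)
    also have "E (Q i) = smult (fact i) (c i)"
      by (simp add: c_def)
    also have "of_nat (N choose i) * (smult (fact (N - i)) (fps_nth (H * g ^ i) (N - i)) * smult (fact i) (c i))
        = smult (of_nat (N choose i) * (fact (N - i) * fact i)) (c i * fps_nth (H * g ^ i) (N - i))"
      by (simp add: of_nat_poly mult_ac)
    also have "of_nat (N choose i) * (fact (N - i) * fact i) = (fact N :: complex)"
      using that by (simp add: binomial_fact)
    finally show ?thesis .
  qed
  have "E ((umb \<gamma> + umb k\<alpha>) ^ N) = smult (fact N) (fps_nth (H * F) N)"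
    using eval_weighted[of 1 "umb \<gamma> + umb k\<alpha>" N] by (simp add: gf_lhs)
  also have "\<dots> = (\<Sum>i = 0..N. E (of_nat (N choose i) * P i ^ (N - i) * Q i))"
    by (simp add: fps_Lagrange_expansion[OF gu g0 c0 gf_Q] smult_sum_right eval_term atLeast0AtMost)
  finally have main: "E ((umb \<gamma> + umb k\<alpha>) ^ N) = E (\<Sum>i = 0..N. of_nat (N choose i) * P i ^ (N - i) * Q i)"
    by (simp add: eval_sum)
  \<comment> \<open>The two right-hand sides agree already as umbral polynomials, before evaluation.
    The binomial formula is lifted from the complex numbers through \<open>complex poly\<close> to
    the constants.\<close>
  have "fact N * (\<Sum>i = 0..N. (umb_const [:1 / fact (N - i):] * P i ^ (N - i)) * (umb_const [:1 / fact i:] * Q i))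
      = (\<Sum>i = 0..N. of_nat (N choose i) * P i ^ (N - i) * Q i)"
    unfolding sum_distrib_left
  proof (rule sum.cong)
    fix i assume "i \<in> {0..N}"
    then have "of_nat (N choose i) = (fact N * (1 / fact (N - i)) * (1 / fact i) :: complex)"
      by (simp add: binomial_fact)
    then have "(of_nat (N choose i) :: complex poly) = of_nat (fact N) * [:1 / fact (N - i):] * [:1 / fact i:]"
      by (simp add: of_nat_poly)
    then have "(of_nat (N choose i) :: 'a umbral_poly)
        = fact N * umb_const [:1 / fact (N - i):] * umb_const [:1 / fact i:]"
      using umb_const_of_nat[of "N choose i", where ?'a = 'a] umb_const_of_nat[of "fact N", where ?'a = 'a]
      by (simp only: umb_const_mult of_nat_fact)
    then show "fact N * (umb_const [:1 / fact (N - i):] * P i ^ (N - i) * (umb_const [:1 / fact i:] * Q i))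
        = of_nat (N choose i) * P i ^ (N - i) * Q i"
      by (simp add: mult_ac)
  qed simp
  with main show ?thesis
    by (simp add: umb_equiv_def P_def Q_def flip: N_def)
qed

end
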